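(* Let $Z_1,\dots,Z_n$ be random variables with values in $[0,1]$ that are independent under each of two hypotheses (null and alternative), with common mean $\mu_0$ under the null and common mean $\mu_0+\Delta$ under the alternative, where $\Delta>0$ and both means are known. Consider the test that rejects the null if $\bar Z_n\ge\mu_0+\Delta/2$, where $\bar Z_n=\frac1n\sum_{i=1}^nZ_i$. Then each error probability (rejection under the null; non-rejection under the alternative) is at most $\exp(-n\Delta^2/2)$. Consequently, for $0<\alpha,\beta<1$, the condition $$n\ge\frac{2}{\Delta^2}\max\left\{\log\frac1\alpha,\log\frac1\beta\right\}$$ suffices for the test to have level $\alpha$ (null rejection probability at most $\alpha$) and power at least $1-\beta$ (alternative rejection probability at least $1-\beta$).
   Context: The variables $Z_i$ need not be identically distributed under either hypothesis; only independence, boundedness in $[0,1]$ and the stated common means are assumed. *)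

theory Defs
  imports "HOL-Probability.Probability"
begin

definition sample_mean :: "nat \<Rightarrow> (nat \<Rightarrow> 'a \<Rightarrow> real) \<Rightarrow> 'a \<Rightarrow> real" where
  "sample_mean n Z \<omega> = (1 / real n) * (\<Sum>i=1..n. Z i \<omega>)"

text \<open>Both means are known, so the midpoint test may depend on \<open>\<mu>\<^sub>0\<close> and \<open>\<Delta>\<close>.\<close>

definition rejects :: "real \<Rightarrow> real \<Rightarrow> nat \<Rightarrow> (nat \<Rightarrow> 'a \<Rightarrow> real) \<Rightarrow> 'a \<Rightarrow> bool" where
  "rejects \<mu>\<^sub>0 \<Delta> n Z \<omega> \<longleftrightarrow> sample_mean n Z \<omega> \<ge> \<mu>\<^sub>0 + \<Delta> / 2"

text \<open>
  A hypothesis is a probability measure \<open>P\<close> on the sample space on which the observations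
  \<open>Z 1, \<dots>, Z n\<close> are defined. Under it they are independent (which includes measurability)
  with common mean \<open>\<mu>\<close>, but not necessarily identically distributed.
\<close>

definition indep_common_mean ::
    "'a measure \<Rightarrow> nat \<Rightarrow> (nat \<Rightarrow> 'a \<Rightarrow> real) \<Rightarrow> real \<Rightarrow> bool" where
  "indep_common_mean P n Z \<mu> \<longleftrightarrow>
     prob_space P \<and>
     prob_space.indep_vars P (\<lambda>_. borel) Z {1..n} \<and>
     (\<forall>i\<in>{1..n}. prob_space.expectation P (Z i) = \<mu>)"

end

theory Submission
  imports Defs
begin

text \<open>The threshold \<open>\<mu>\<^sub>0 + \<Delta> / 2\<close> lies midway between the two
  means, so either error forces the sample mean to deviate from its true mean by at least
  \<open>\<Delta> / 2\<close>: upwards under the null, downwards under the alternative. Hoeffding's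
  inequality for independent variables in [0,1] bounds a one-sided deviation by \<epsilon> with
  exp(-2 n \<epsilon>^2) (\<open>sample_mean_Hoeffding\<close>), and \<epsilon> = \<Delta>/2 gives
  exp(-n \<Delta>^2 / 2). Solving exp(-n \<Delta>^2 / 2) \<le> \<gamma> for n gives the sample size
  (\<open>exp_neg_le_of_sample_size\<close>), used with \<gamma> = \<alpha> for the level and
  \<gamma> = \<beta> for the power.\<close>

lemma sample_mean_measurable:
  assumes "indep_common_mean P n Z \<mu>"
  shows "sample_mean n Z \<in> borel_measurable P"
proof -
  interpret prob_space P
    using assms by (simp add: indep_common_mean_def)
  have [measurable]: "Z i \<in> borel_measurable P" if "i \<in> {1..n}" for i
    using assms that unfolding indep_common_mean_def indep_vars_def by blast
  show ?thesis
    unfolding sample_mean_def[abs_def] by measurable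
qed

text \<open>A rescaling of Hoeffding's inequality for sums: a deviation \<epsilon> of the mean is a
  deviation n \<epsilon> of the sum, and the n intervals of length 1 have squared lengths adding up
  to n, so the exponent is -2 (n \<epsilon>)^2 / n. The upper tail serves the null, the lower tail
  the alternative.\<close>

lemma sample_mean_Hoeffding:
  assumes n: "n \<ge> 1"
    and indep: "indep_common_mean P n Z \<mu>"
    and range: "\<And>i \<omega>. i \<in> {1..n} \<Longrightarrow> \<omega> \<in> space P \<Longrightarrow> Z i \<omega> \<in> {0..1}"
    and \<epsilon>: "\<epsilon> \<ge> 0"
  shows sample_mean_Hoeffding_ge:
      "measure P {\<omega> \<in> space P. sample_mean n Z \<omega> \<ge> \<mu> + \<epsilon>} \<le> exp (- 2 * real n * \<epsilon>\<^sup>2)"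
    and sample_mean_Hoeffding_le:
      "measure P {\<omega> \<in> space P. sample_mean n Z \<omega> \<le> \<mu> - \<epsilon>} \<le> exp (- 2 * real n * \<epsilon>\<^sup>2)"
proof -
  interpret prob_space P
    using indep by (simp add: indep_common_mean_def)
  interpret Hoeffding_ineq P "{1..n}" Z "\<lambda>_. 0" "\<lambda>_. 1" "real n * \<mu>"
  proof unfold_locales
    show "indep_vars (\<lambda>_. borel) Z {1..n}"
      using indep by (simp add: indep_common_mean_def)
    show "AE \<omega> in P. Z i \<omega> \<in> {0..1}" if "i \<in> {1..n}" for i
      using range[OF that] by (intro AE_I2) auto
    have "(\<Sum>i\<in>{1..n}. expectation (Z i)) = (\<Sum>i\<in>{1..n}. \<mu>)"
      using indep by (intro sum.cong) (auto simp: indep_common_mean_def)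
    then show "real n * \<mu> \<equiv> \<Sum>i\<in>{1..n}. expectation (Z i)"
      by simp
  qed simp
  \<comment> \<open>This sum is the denominator in Hoeffding's exponent; it equals n, hence is
    positive as n \<ge> 1.\<close>
  have pos: "(\<Sum>i\<in>{1..n}. (1 - 0 :: real)\<^sup>2) > 0"
    using n by simp
  have n\<epsilon>: "real n * \<epsilon> \<ge> 0"
    using \<epsilon> by simp
  have exponent: "- 2 * (real n * \<epsilon>)\<^sup>2 / real n = - 2 * real n * \<epsilon>\<^sup>2"
    using n by (simp add: power2_eq_square)
  have ge: "sample_mean n Z \<omega> \<ge> \<mu> + \<epsilon> \<longleftrightarrow> (\<Sum>i\<in>{1..n}. Z i \<omega>) \<ge> real n * \<mu> + real n * \<epsilon>" for \<omega>
    using n by (simp add: sample_mean_def field_simps)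
  have le: "sample_mean n Z \<omega> \<le> \<mu> - \<epsilon> \<longleftrightarrow> (\<Sum>i\<in>{1..n}. Z i \<omega>) \<le> real n * \<mu> - real n * \<epsilon>" for \<omega>
    using n by (simp add: sample_mean_def field_simps)
  show "prob {\<omega> \<in> space P. sample_mean n Z \<omega> \<ge> \<mu> + \<epsilon>} \<le> exp (- 2 * real n * \<epsilon>\<^sup>2)"
    using Hoeffding_ineq_ge[OF n\<epsilon> pos] exponent unfolding ge by simp
  show "prob {\<omega> \<in> space P. sample_mean n Z \<omega> \<le> \<mu> - \<epsilon>} \<le> exp (- 2 * real n * \<epsilon>\<^sup>2)"
    using Hoeffding_ineq_le[OF n\<epsilon> pos] exponent unfolding le by simp
qed

text \<open>Multiplying the size condition by \<Delta>^2 / 2 leaves ln (1 / \<gamma>) = - ln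
  \<gamma> on one side; exponentiating then gives the bound.\<close>

lemma exp_neg_le_of_sample_size:
  fixes \<Delta> \<gamma> N :: real
  assumes "\<Delta> > 0" "\<gamma> > 0" "N \<ge> 2 / \<Delta>\<^sup>2 * ln (1 / \<gamma>)"
  shows "exp (- N * \<Delta>\<^sup>2 / 2) \<le> \<gamma>"
proof -
  have "ln (1 / \<gamma>) \<le> N * \<Delta>\<^sup>2 / 2"
    using assms by (simp add: field_simps)
  then have "- N * \<Delta>\<^sup>2 / 2 \<le> ln \<gamma>"
    using assms by (simp add: ln_div)
  then have "exp (- N * \<Delta>\<^sup>2 / 2) \<le> exp (ln \<gamma>)"
    by (simp only: exp_le_cancel_iff)
  then show ?thesis
    using assms by simp
qed

theorem proposition6p2:
  fixes P0 P1 :: "'a measure"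
    and Z :: "nat \<Rightarrow> 'a \<Rightarrow> real"
    and n :: nat
    and \<mu>\<^sub>0 \<Delta> :: real
  assumes n: "n \<ge> 1"
    and same_space: "sets P0 = sets P1"
    and range: "\<And>i \<omega>. i \<in> {1..n} \<Longrightarrow> \<omega> \<in> space P0 \<Longrightarrow> Z i \<omega> \<in> {0..1}"
    and null: "indep_common_mean P0 n Z \<mu>\<^sub>0"
    and alternative: "indep_common_mean P1 n Z (\<mu>\<^sub>0 + \<Delta>)"
    and gap: "\<Delta> > 0"
  shows "measure P0 {\<omega> \<in> space P0. rejects \<mu>\<^sub>0 \<Delta> n Z \<omega>} \<le> exp (- real n * \<Delta>\<^sup>2 / 2) \<and>
         measure P1 {\<omega> \<in> space P1. \<not> rejects \<mu>\<^sub>0 \<Delta> n Z \<omega>} \<le> exp (- real n * \<Delta>\<^sup>2 / 2) \<and>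
         (\<forall>\<alpha> \<beta>. 0 < \<alpha> \<and> \<alpha> < 1 \<and> 0 < \<beta> \<and> \<beta> < 1 \<and>
                real n \<ge> 2 / \<Delta>\<^sup>2 * max (ln (1 / \<alpha>)) (ln (1 / \<beta>)) \<longrightarrow>
            measure P0 {\<omega> \<in> space P0. rejects \<mu>\<^sub>0 \<Delta> n Z \<omega>} \<le> \<alpha> \<and>
            measure P1 {\<omega> \<in> space P1. rejects \<mu>\<^sub>0 \<Delta> n Z \<omega>} \<ge> 1 - \<beta>)"
proof (intro conjI allI impI)
  interpret P1: prob_space P1
    using alternative by (simp add: indep_common_mean_def)
  \<comment> \<open>The range is assumed on \<open>space P0\<close> only; equal sigma-algebras have
    the same underlying space.\<close>
  have range1: "Z i \<omega> \<in> {0..1}" if "i \<in> {1..n}" "\<omega> \<in> space P1" for i \<omega>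
    using range that sets_eq_imp_space_eq[OF same_space] by simp
  have half: "\<Delta> / 2 \<ge> 0"
    using gap by simp
  have exponent: "- 2 * real n * (\<Delta> / 2)\<^sup>2 = - real n * \<Delta>\<^sup>2 / 2"
    by (simp add: power2_eq_square)
  note [measurable] = sample_mean_measurable[OF alternative]

  show type1: "measure P0 {\<omega> \<in> space P0. rejects \<mu>\<^sub>0 \<Delta> n Z \<omega>} \<le> exp (- real n * \<Delta>\<^sup>2 / 2)"
    using sample_mean_Hoeffding_ge[OF n null range half]
    unfolding rejects_def exponent .

  \<comment> \<open>Non-rejection is the strict inequality below the midpoint. Weakening it and
    writing the midpoint as \<open>\<mu>\<^sub>0 + \<Delta> - \<Delta> / 2\<close> gives a lower
    tail around the alternative mean.\<close>
  have "measure P1 {\<omega> \<in> space P1. \<not> rejects \<mu>\<^sub>0 \<Delta> n Z \<omega>}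
      \<le> measure P1 {\<omega> \<in> space P1. sample_mean n Z \<omega> \<le> \<mu>\<^sub>0 + \<Delta> - \<Delta> / 2}"
    by (intro P1.finite_measure_mono) (auto simp: rejects_def)
  also have "\<dots> \<le> exp (- real n * \<Delta>\<^sup>2 / 2)"
    using sample_mean_Hoeffding_le[OF n alternative range1 half] unfolding exponent .
  finally show type2:
    "measure P1 {\<omega> \<in> space P1. \<not> rejects \<mu>\<^sub>0 \<Delta> n Z \<omega>} \<le> exp (- real n * \<Delta>\<^sup>2 / 2)" .

  fix \<alpha> \<beta> :: real
  assume H: "0 < \<alpha> \<and> \<alpha> < 1 \<and> 0 < \<beta> \<and> \<beta> < 1 \<and>
    real n \<ge> 2 / \<Delta>\<^sup>2 * max (ln (1 / \<alpha>)) (ln (1 / \<beta>))"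
  \<comment> \<open>The maximum dominates both logarithms, so one condition covers both error
    levels.\<close>
  have size: "real n \<ge> 2 / \<Delta>\<^sup>2 * ln (1 / \<gamma>)" if "\<gamma> \<in> {\<alpha>, \<beta>}" for \<gamma>
  proof -
    have "2 / \<Delta>\<^sup>2 * ln (1 / \<gamma>) \<le> 2 / \<Delta>\<^sup>2 * max (ln (1 / \<alpha>)) (ln (1 / \<beta>))"
      using that by (intro mult_left_mono) auto
    with H show ?thesis
      by linarith
  qed
  show "measure P0 {\<omega> \<in> space P0. rejects \<mu>\<^sub>0 \<Delta> n Z \<omega>} \<le> \<alpha>"
    using type1 exp_neg_le_of_sample_size[OF gap _ size, of \<alpha>] H by simp
  \<comment> \<open>Power is one minus the second error probability; taking the complement requires
    the rejection event to be measurable.\<close>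
  have "{\<omega> \<in> space P1. rejects \<mu>\<^sub>0 \<Delta> n Z \<omega>} \<in> P1.events"
    unfolding rejects_def by measurable
  then have "measure P1 {\<omega> \<in> space P1. \<not> rejects \<mu>\<^sub>0 \<Delta> n Z \<omega>}
      = 1 - measure P1 {\<omega> \<in> space P1. rejects \<mu>\<^sub>0 \<Delta> n Z \<omega>}"
    by (rule P1.prob_neg)
  then show "measure P1 {\<omega> \<in> space P1. rejects \<mu>\<^sub>0 \<Delta> n Z \<omega>} \<ge> 1 - \<beta>"
    using type2 exp_neg_le_of_sample_size[OF gap _ size, of \<beta>] H by simp
qed

end
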